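(* Let $m\in\mathbb{N}$ and let $n=km$ (with $k\in\mathbb{N}$) be any multiple of $m$. The dynamics of the $n$-dimensional Lorenz-96 model restricted to the invariant manifold $\mathrm{Fix}(G_n^m)$ is topologically equivalent to the Lorenz-96 model of dimension $m$ (with the same parameter value $F$).
   Context: The $n$-dimensional Lorenz-96 model with parameter $F\in\mathbb{R}$ is the system of ordinary differential equations on $\mathbb{R}^n$ given by $\dot{x}_j = x_{j-1}(x_{j+1}-x_{j-2}) - x_j + F$, $j=1,\ldots,n$, where all indices are taken modulo $n$ (i.e. $x_{j-n}=x_{j+n}=x_j$). Let $\gamma_n:\mathbb{R}^n\to\mathbb{R}^n$ be the cyclic left shift $\gamma_n(x_1,\ldots,x_n)=(x_2,\ldots,x_n,x_1)$. For $0<m\le n$ with $m\mid n$ let $G_n^m=\langle\gamma_n^m\rangle$, and let $\mathrm{Fix}(G_n^m)=\{x\in\mathbb{R}^n:\gamma x=x\text{ for all }\gamma\in G_n^m\}$; equivalently, it is the set of all $x\in\mathbb{R}^n$ with $x_{j+m}=x_j$ for all $j$ (indices modulo $n$). It is an $m$-dimensional linear subspace that is invariant under the flow of the $n$-dimensional Lorenz-96 model. Two dynamical systems are topologically equivalent if there is a homeomorphism between their phase spaces mapping orbits of the first onto orbits of the second and preserving the direction of time. *)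

theory Defs
  imports "HOL-Analysis.Analysis" "HOL-Algebra.Bij" "HOL-Algebra.Generated_Groups"
begin

text \<open>
  A dynamical system: \<open>evol D x t\<close> is the state at time \<open>t\<close> of the point that is at \<open>x\<close> at time
  \<open>0\<close>; it is meaningful for \<open>t \<in> times D x\<close>, the interval of existence.
\<close>

record 'a dynsys =
  phase :: "'a topology"
  times :: "'a \<Rightarrow> real set"
  evol :: "'a \<Rightarrow> real \<Rightarrow> 'a"

definition dyn_orbit :: "'a dynsys \<Rightarrow> 'a \<Rightarrow> 'a set" where
  "dyn_orbit D x = evol D x ` times D x"

definition invariant_set :: "'a dynsys \<Rightarrow> 'a set \<Rightarrow> bool" where
  "invariant_set D A \<longleftrightarrow> (\<forall>x\<in>A. dyn_orbit D x \<subseteq> A)"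

definition restrict_dynsys :: "'a dynsys \<Rightarrow> 'a set \<Rightarrow> 'a dynsys" where
  "restrict_dynsys D A = D\<lparr>phase := subtopology (phase D) A\<rparr>"

text \<open>
  The first two conjuncts say that both evolutions take place in the respective phase space; for a
  restricted system this is the invariance of the set restricted to.

  The last conjunct is the preservation of the direction of time: along each orbit, \<open>h\<close> matches the
  two motions up to an increasing reparametrisation \<open>\<tau>\<close> of time. Continuity of \<open>\<tau>\<close> and of its
  inverse is automatic, since \<open>\<tau>\<close> is a monotone bijection between intervals.
\<close>

definition topologically_equivalent :: "'a dynsys \<Rightarrow> 'b dynsys \<Rightarrow> bool" where
  "topologically_equivalent D E \<longleftrightarrow>
     invariant_set D (topspace (phase D)) \<and>
     invariant_set E (topspace (phase E)) \<and>
     (\<exists>h. homeomorphic_map (phase D) (phase E) h \<and>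
          (\<forall>x\<in>topspace (phase D).
             h ` dyn_orbit D x = dyn_orbit E (h x) \<and>
             (\<exists>\<tau>::real \<Rightarrow> real.
                strict_mono_on (times D x) \<tau> \<and> \<tau> ` times D x = times E (h x) \<and> \<tau> 0 = 0 \<and>
                (\<forall>t\<in>times D x. h (evol D x t) = evol E (h x) (\<tau> t)))))"

text \<open>
  Points of \<open>\<real>\<^sup>n\<close> are the elements of \<open>topspace (Euclidean_space n)\<close>, that is, functions
  \<open>nat \<Rightarrow> real\<close> vanishing from \<open>n\<close> on. Coordinates are numbered \<open>0, \<dots>, n - 1\<close>. Indices are integers
  read modulo \<open>n\<close>, so that \<open>j - 2\<close> wraps around also when \<open>n\<close> is \<open>1\<close> or \<open>2\<close>.
\<close>

definition cyc :: "nat \<Rightarrow> (nat \<Rightarrow> real) \<Rightarrow> int \<Rightarrow> real" where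
  "cyc n x j = x (nat (j mod int n))"

definition lorenz96_field :: "nat \<Rightarrow> real \<Rightarrow> (nat \<Rightarrow> real) \<Rightarrow> nat \<Rightarrow> real" where
  "lorenz96_field n F x j =
     cyc n x (int j - 1) * (cyc n x (int j + 1) - cyc n x (int j - 2)) - cyc n x (int j) + F"

definition lorenz96_solution ::
  "nat \<Rightarrow> real \<Rightarrow> real set \<Rightarrow> (real \<Rightarrow> nat \<Rightarrow> real) \<Rightarrow> bool" where
  "lorenz96_solution n F I u \<longleftrightarrow>
     open I \<and> is_interval I \<and>
     (\<forall>t\<in>I. u t \<in> topspace (Euclidean_space n) \<and>
        (\<forall>j<n. ((\<lambda>s. u s j) has_real_derivative lorenz96_field n F (u t) j) (at t)))"

text \<open>The union of the intervals on which the initial value problem is solvable.\<close>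

definition lorenz96_times :: "nat \<Rightarrow> real \<Rightarrow> (nat \<Rightarrow> real) \<Rightarrow> real set" where
  "lorenz96_times n F x =
     {t. \<exists>I u. lorenz96_solution n F I u \<and> 0 \<in> I \<and> t \<in> I \<and> u 0 = x}"

definition lorenz96_flow :: "nat \<Rightarrow> real \<Rightarrow> (nat \<Rightarrow> real) \<Rightarrow> real \<Rightarrow> nat \<Rightarrow> real" where
  "lorenz96_flow n F x t =
     (THE y. \<exists>I u. lorenz96_solution n F I u \<and> 0 \<in> I \<and> t \<in> I \<and> u 0 = x \<and> u t = y)"

definition lorenz96 :: "nat \<Rightarrow> real \<Rightarrow> (nat \<Rightarrow> real) dynsys" where
  "lorenz96 n F =
     \<lparr>phase = Euclidean_space n, times = lorenz96_times n F, evol = lorenz96_flow n F\<rparr>"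

definition left_shift :: "nat \<Rightarrow> (nat \<Rightarrow> real) \<Rightarrow> nat \<Rightarrow> real" where
  "left_shift n x = (\<lambda>j. if j < n then cyc n x (int j + 1) else 0)"

text \<open>
  The subgroup generated by the \<open>m\<close>-th power of the shift, in the group of bijections of \<open>\<real>\<^sup>n\<close>; the
  elements of \<open>BijGroup\<close> are extensional functions, whence the \<open>restrict\<close>.
\<close>

definition shift_group :: "nat \<Rightarrow> nat \<Rightarrow> ((nat \<Rightarrow> real) \<Rightarrow> nat \<Rightarrow> real) set" where
  "shift_group n m =
     generate (BijGroup (topspace (Euclidean_space n)))
       {restrict (left_shift n ^^ m) (topspace (Euclidean_space n))}"

definition fix_space :: "nat \<Rightarrow> ((nat \<Rightarrow> real) \<Rightarrow> nat \<Rightarrow> real) set \<Rightarrow> (nat \<Rightarrow> real) set" where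
  "fix_space n G = {x \<in> topspace (Euclidean_space n). \<forall>\<gamma>\<in>G. \<gamma> x = x}"

end

theory Submission
  imports Defs
begin

text \<open>
  Repeating an \<open>m\<close>-dimensional state \<open>k\<close> times identifies \<open>\<real>\<^sup>m\<close> linearly with the fixed space and
  carries the \<open>m\<close>-dimensional vector field to the restriction of the \<open>n\<close>-dimensional one, so it maps
  solutions to solutions. Conversely, the field commutes with the shift, so uniqueness of solutions
  keeps every solution that starts in the fixed space inside it, and such a solution is determined
  by its first \<open>m\<close> components. Time need not be reparametrised.
\<close>

section \<open>Uniqueness of solutions\<close>

text \<open>The integrating factor \<open>exp (- L * s)\<close> makes \<open>d\<close> nonincreasing
  forward from 0, and \<open>exp (L * s)\<close> makes it nondecreasing up to 0 in backward time.
  Bounding the absolute value of the derivative serves both directions.\<close>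

lemma gronwall_zero:
  fixes d :: "real \<Rightarrow> real"
  assumes deriv: "\<And>s. s \<in> closed_segment 0 t \<Longrightarrow> (d has_real_derivative d' s) (at s)"
    and bound: "\<And>s. s \<in> closed_segment 0 t \<Longrightarrow> \<bar>d' s\<bar> \<le> L * d s"
    and "d 0 = 0"
  shows "d t \<le> 0"
proof (cases "0 \<le> t")
  case True
  have "d 0 * exp (- L * 0) \<ge> d t * exp (- L * t)"
  proof (rule DERIV_nonpos_imp_nonincreasing[where f = "\<lambda>s. d s * exp (- L * s)", OF True])
    fix s assume "0 \<le> s" "s \<le> t"
    then have s: "s \<in> closed_segment 0 t" by (auto simp: closed_segment_eq_real_ivl)
    have "((\<lambda>s. d s * exp (- L * s)) has_real_derivative (d' s - L * d s) * exp (- L * s)) (at s)"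
      by (auto intro!: derivative_eq_intros deriv[OF s] simp: algebra_simps)
    moreover have "(d' s - L * d s) * exp (- L * s) \<le> 0"
      using bound[OF s] by (intro mult_nonpos_nonneg) auto
    ultimately show "\<exists>y. ((\<lambda>s. d s * exp (- L * s)) has_real_derivative y) (at s) \<and> y \<le> 0"
      by blast
  qed
  then show ?thesis using \<open>d 0 = 0\<close> by (simp add: mult_le_0_iff)
next
  case False
  have "d t * exp (L * t) \<le> d 0 * exp (L * 0)"
  proof (rule DERIV_nonneg_imp_nondecreasing[where f = "\<lambda>s. d s * exp (L * s)"])
    show "t \<le> 0" using False by simp
    fix s assume "t \<le> s" "s \<le> 0"
    then have s: "s \<in> closed_segment 0 t" by (auto simp: closed_segment_eq_real_ivl)
    have "((\<lambda>s. d s * exp (L * s)) has_real_derivative (d' s + L * d s) * exp (L * s)) (at s)"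
      by (auto intro!: derivative_eq_intros deriv[OF s] simp: algebra_simps)
    moreover have "(d' s + L * d s) * exp (L * s) \<ge> 0"
      using bound[OF s] by (intro mult_nonneg_nonneg) auto
    ultimately show "\<exists>y. ((\<lambda>s. d s * exp (L * s)) has_real_derivative y) (at s) \<and> y \<ge> 0"
      by blast
  qed
  then show ?thesis using \<open>d 0 = 0\<close> by (simp add: mult_le_0_iff)
qed

lemma nat_mod_less: "0 < n \<Longrightarrow> nat (j mod int n) < n"
  by (simp add: nat_less_iff)

text \<open>The field is quadratic, hence Lipschitz only on bounded sets; this is where
  \<open>M\<close> enters. The left-hand side is half the derivative of one squared coordinate
  difference along two solutions, the form needed for the Gronwall argument.\<close>

lemma lorenz96_field_diff_bound:
  fixes x y :: "nat \<Rightarrow> real"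
  assumes n: "0 < n" and j: "j < n"
    and x: "\<And>i. i < n \<Longrightarrow> \<bar>x i\<bar> \<le> M" and y: "\<And>i. i < n \<Longrightarrow> \<bar>y i\<bar> \<le> M"
  shows "\<bar>(x j - y j) * (lorenz96_field n F x j - lorenz96_field n F y j)\<bar>
           \<le> (4 * M + 1) * (\<Sum>i<n. (x i - y i)\<^sup>2)"
proof -
  define d where "d = (\<Sum>i<n. (x i - y i)\<^sup>2)"
  define w where "w i = cyc n x i - cyc n y i" for i
  have sq: "(x i - y i)\<^sup>2 \<le> d" if "i < n" for i
    unfolding d_def using that by (intro member_le_sum) auto
  have w: "\<bar>w i\<bar> \<le> sqrt d" for i
    using sq[OF nat_mod_less[OF n]] by (auto simp: w_def cyc_def intro: real_le_rsqrt)
  have xj: "\<bar>x j - y j\<bar> \<le> sqrt d"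
    using sq[OF j] by (auto intro: real_le_rsqrt)
  have d0: "0 \<le> d" unfolding d_def by (simp add: sum_nonneg)
  have ww: "\<bar>(x j - y j) * w i\<bar> \<le> d" for i
    using mult_mono[OF xj w[of i]] d0 by (simp add: abs_mult)
  have cx: "\<bar>cyc n x i\<bar> \<le> M" and cy: "\<bar>cyc n y i\<bar> \<le> M" for i
    using x[OF nat_mod_less[OF n]] y[OF nat_mod_less[OF n]] by (auto simp: cyc_def)
  have prod: "\<bar>c * ((x j - y j) * w i)\<bar> \<le> M * d" if "\<bar>c\<bar> \<le> M" for c i
    using mult_mono[OF that ww[of i]] that by (simp add: abs_mult)
  let ?j = "int j"
  \<comment> \<open>Each product difference is split as a b - a' b' = a (b - b') + b' (a - a'), and
    \<open>F\<close> cancels. The four quadratic terms cost \<open>M * d\<close> each and the linear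
    one \<open>d\<close>, whence \<open>4 * M + 1\<close>.\<close>
  have "(x j - y j) * (lorenz96_field n F x j - lorenz96_field n F y j) =
      cyc n x (?j - 1) * ((x j - y j) * w (?j + 1)) - cyc n x (?j - 1) * ((x j - y j) * w (?j - 2))
      + cyc n y (?j + 1) * ((x j - y j) * w (?j - 1)) - cyc n y (?j - 2) * ((x j - y j) * w (?j - 1))
      - (x j - y j) * w ?j"
    by (simp add: lorenz96_field_def w_def algebra_simps)
  also have "\<bar>\<dots>\<bar> \<le> (4 * M + 1) * d"
    using prod[OF cx, of "?j - 1" "?j + 1"] prod[OF cx, of "?j - 1" "?j - 2"]
      prod[OF cy, of "?j + 1" "?j - 1"] prod[OF cy, of "?j - 2" "?j - 1"] ww[of ?j]
    unfolding distrib_right mult_1 by linarith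
  finally show ?thesis by (simp add: d_def)
qed

lemma lorenz96_solution_deriv:
  assumes "lorenz96_solution n F I u" "t \<in> I" "j < n"
  shows "((\<lambda>s. u s j) has_real_derivative lorenz96_field n F (u t) j) (at t)"
  using assms by (simp add: lorenz96_solution_def)

lemma lorenz96_solution_zero:
  assumes "lorenz96_solution n F I u" "t \<in> I" "n \<le> j"
  shows "u t j = 0"
  using assms by (simp add: lorenz96_solution_def topspace_Euclidean_space)

lemma lorenz96_solution_segment:
  assumes "lorenz96_solution n F I u" "0 \<in> I" "t \<in> I"
  shows "closed_segment 0 t \<subseteq> I"
  using assms by (intro closed_segment_subset) (auto simp: lorenz96_solution_def is_interval_convex_1)

text \<open>The solutions may live on different intervals, but both contain the compact segment from
  0 to \<open>t\<close>. Both are bounded there, so Gronwall applies to their squared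
  distance.\<close>

lemma lorenz96_solution_unique:
  assumes n: "0 < n"
    and u: "lorenz96_solution n F I u" "0 \<in> I" "t \<in> I"
    and v: "lorenz96_solution n F J v" "0 \<in> J" "t \<in> J"
    and eq: "u 0 = v 0"
  shows "u t = v t"
proof -
  let ?S = "closed_segment 0 t"
  note uS = subsetD[OF lorenz96_solution_segment[OF u]]
    and vS = subsetD[OF lorenz96_solution_segment[OF v]]
  note du = lorenz96_solution_deriv[OF u(1) uS] and dv = lorenz96_solution_deriv[OF v(1) vS]
  \<comment> \<open>A single continuous function dominating all coordinates of both solutions, so
    that compactness yields one bound \<open>M\<close>.\<close>
  define b where "b s = (\<Sum>i<n. \<bar>u s i\<bar> + \<bar>v s i\<bar>)" for s
  have "continuous_on ?S b"
    unfolding b_def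
    by (intro continuous_intros)
      (auto intro!: continuous_at_imp_continuous_on DERIV_isCont du dv)
  then have "bounded (b ` ?S)"
    by (intro compact_imp_bounded compact_continuous_image) auto
  then obtain M where "\<forall>y\<in>b ` ?S. \<bar>y\<bar> \<le> M"
    unfolding bounded_real by blast
  then have M: "b s \<le> M" if "s \<in> ?S" for s
    using that by (meson abs_le_D1 imageI)
  have le: "\<bar>u s i\<bar> + \<bar>v s i\<bar> \<le> M" if "s \<in> ?S" "i < n" for s i
  proof -
    have "\<bar>u s i\<bar> + \<bar>v s i\<bar> \<le> b s"
      unfolding b_def using that by (intro member_le_sum) auto
    then show ?thesis using M[OF that(1)] by simp
  qed
  define d where "d s = (\<Sum>i<n. (u s i - v s i)\<^sup>2)" for s
  let ?g = "\<lambda>s i. (u s i - v s i) * (lorenz96_field n F (u s) i - lorenz96_field n F (v s) i)"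
  have "d t \<le> 0"
  \<comment> \<open>In \<open>L\<close>, the factor 2 comes from differentiating a square and
    \<open>real n\<close> from summing the same bound over all components.\<close>
  proof (rule gronwall_zero[where d = d and d' = "\<lambda>s. \<Sum>i<n. 2 * ?g s i"
        and L = "real n * (2 * (4 * M + 1))"])
    fix s assume s: "s \<in> ?S"
    show "(d has_real_derivative (\<Sum>i<n. 2 * ?g s i)) (at s)"
      unfolding d_def
      by (intro DERIV_sum) (auto intro!: derivative_eq_intros du[OF s] dv[OF s])
    have "\<bar>?g s i\<bar> \<le> (4 * M + 1) * d s" if "i < n" for i
      unfolding d_def using le[OF s] by (intro lorenz96_field_diff_bound n that) fastforce+
    then have "\<bar>2 * ?g s i\<bar> \<le> 2 * ((4 * M + 1) * d s)" if "i < n" for i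
      using that unfolding abs_mult by fastforce
    then have "(\<Sum>i<n. \<bar>2 * ?g s i\<bar>) \<le> real n * (2 * ((4 * M + 1) * d s))"
      using sum_bounded_above[of "{..<n}" "\<lambda>i. \<bar>2 * ?g s i\<bar>"] by simp
    then show "\<bar>\<Sum>i<n. 2 * ?g s i\<bar> \<le> (real n * (2 * (4 * M + 1))) * d s"
      using sum_abs[of "\<lambda>i. 2 * ?g s i" "{..<n}"] unfolding mult.assoc by linarith
  next
    show "d 0 = 0" by (simp add: d_def eq)
  qed
  then have "d t = 0" by (simp add: d_def sum_nonneg order_antisym)
  then have "u t j = v t j" if "j < n" for j
    using that by (simp add: d_def sum_nonneg_eq_0_iff)
  then show ?thesis
    using lorenz96_solution_zero[OF u(1,3)] lorenz96_solution_zero[OF v(1,3)]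
    by (metis ext not_le_imp_less)
qed

text \<open>Uniqueness makes the definite description in the flow meaningful, so any solution
  computes it.\<close>

lemma lorenz96_flow_eq:
  assumes "0 < n" "lorenz96_solution n F I u" "0 \<in> I" "t \<in> I"
  shows "lorenz96_flow n F (u 0) t = u t"
  unfolding lorenz96_flow_def
proof (rule the_equality)
  show "\<exists>J v. lorenz96_solution n F J v \<and> 0 \<in> J \<and> t \<in> J \<and> v 0 = u 0 \<and> v t = u t"
    using assms by blast
qed (use assms lorenz96_solution_unique in metis)

lemma lorenz96_timesE:
  assumes "0 < n" "t \<in> lorenz96_times n F x"
  obtains I u where "lorenz96_solution n F I u" "0 \<in> I" "t \<in> I" "u 0 = x"
    "lorenz96_flow n F x t = u t"
  using assms lorenz96_flow_eq unfolding lorenz96_times_def by blast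

section \<open>The shift and its fixed space\<close>

lemma cyc_left_shift: "0 < n \<Longrightarrow> cyc n (left_shift n x) j = cyc n x (j + 1)"
  by (simp add: cyc_def left_shift_def nat_mod_less mod_add_left_eq)

text \<open>Equivariance: the same formula defines every component of the field, so shifting the
  state only renumbers the equations.\<close>

lemma lorenz96_solution_left_shift:
  assumes n: "0 < n" and u: "lorenz96_solution n F I u"
  shows "lorenz96_solution n F I (\<lambda>t. left_shift n (u t))"
  unfolding lorenz96_solution_def
proof (intro conjI ballI allI impI)
  show "open I" "is_interval I" using u by (auto simp: lorenz96_solution_def)
  fix t assume t: "t \<in> I"
  show "left_shift n (u t) \<in> topspace (Euclidean_space n)"
    by (simp add: topspace_Euclidean_space left_shift_def)
  fix j assume j: "j < n"
  let ?i = "nat ((int j + 1) mod int n)"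
  \<comment> \<open>\<open>?i\<close> is \<open>j + 1\<close> wrapped around at \<open>n\<close>;
    neighbours may be read off from the unwrapped index instead.\<close>
  have cyc_mod: "cyc n x (int ?i + c) = cyc n x (int j + 1 + c)" for x c
    using n by (simp add: cyc_def mod_add_left_eq)
  have "lorenz96_field n F (u t) ?i = lorenz96_field n F (left_shift n (u t)) j"
    using cyc_mod[of "u t" "-1"] cyc_mod[of "u t" 1] cyc_mod[of "u t" 0] cyc_mod[of "u t" "-2"]
    by (simp add: lorenz96_field_def cyc_left_shift n algebra_simps)
  then show "((\<lambda>s. left_shift n (u s) j) has_real_derivative
      lorenz96_field n F (left_shift n (u t)) j) (at t)"
    using lorenz96_solution_deriv[OF u t nat_mod_less[OF n, of "int j + 1"]] j
    by (simp add: left_shift_def cyc_def)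
qed

lemma lorenz96_solution_shift_power:
  assumes "0 < n" "lorenz96_solution n F I u"
  shows "lorenz96_solution n F I (\<lambda>t. (left_shift n ^^ i) (u t))"
  using assms by (induction i) (auto intro: lorenz96_solution_left_shift)

lemma shift_power_apply:
  assumes "0 < n" "x \<in> topspace (Euclidean_space n)"
  shows "(left_shift n ^^ i) x j = (if j < n then x ((j + i) mod n) else 0)"
proof (induction i arbitrary: j)
  case 0
  then show ?case using assms by (simp add: topspace_Euclidean_space)
next
  case (Suc i)
  have "nat ((int j + 1) mod int n) = Suc j mod n"
    by (metis nat_int of_nat_Suc of_nat_mod add.commute)
  then show ?case
    using assms(1) Suc by (simp add: left_shift_def cyc_def mod_add_left_eq)
qed

lemma shift_power_in_topspace:
  assumes "0 < n" "x \<in> topspace (Euclidean_space n)"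
  shows "(left_shift n ^^ i) x \<in> topspace (Euclidean_space n)"
  using shift_power_apply[OF assms] by (simp add: topspace_Euclidean_space)

lemma shift_power_period:
  assumes "0 < n" "x \<in> topspace (Euclidean_space n)" "n dvd i"
  shows "(left_shift n ^^ i) x = x"
proof
  fix j
  obtain c where "i = n * c" using assms(3) by blast
  then show "(left_shift n ^^ i) x j = x j"
    using assms(2) by (simp add: shift_power_apply[OF assms(1,2)] topspace_Euclidean_space)
qed

text \<open>The inverse is the power \<open>m * (n - 1)\<close>, because the two exponents add up to
  the multiple \<open>n * m\<close> of \<open>n\<close>.\<close>

lemma shift_power_Bij:
  assumes n: "0 < n"
  shows "restrict (left_shift n ^^ m) (topspace (Euclidean_space n))
    \<in> Bij (topspace (Euclidean_space n))"
proof -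
  let ?T = "topspace (Euclidean_space n)" and ?s = "left_shift n"
  have inverse: "(?s ^^ (m * (n - 1))) ((?s ^^ m) x) = x"
    "(?s ^^ m) ((?s ^^ (m * (n - 1))) x) = x" if "x \<in> ?T" for x
  proof -
    have "m * (n - 1) + m = n * m" using n by (cases n) auto
    then show "(?s ^^ (m * (n - 1))) ((?s ^^ m) x) = x" "(?s ^^ m) ((?s ^^ (m * (n - 1))) x) = x"
      using shift_power_period[OF n that, of "n * m"]
      by (metis comp_apply dvd_triv_left funpow_add add.commute)+
  qed
  have "bij_betw (?s ^^ m) ?T ?T"
    by (rule bij_betw_byWitness[where f' = "?s ^^ (m * (n - 1))"])
      (use inverse shift_power_in_topspace[OF n] in auto)
  then show ?thesis by (simp add: Bij_def)
qed

text \<open>The stabiliser of a point is closed under products and inverses, so fixing the generator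
  suffices.\<close>

lemma generate_fixes:
  assumes f: "f \<in> Bij S" and x: "x \<in> S" "f x = x" and \<gamma>: "\<gamma> \<in> generate (BijGroup S) {f}"
  shows "\<gamma> x = x"
  using \<gamma>
proof (induction rule: generate.induct)
  case one
  show ?case using x by (simp add: BijGroup_def)
next
  case (incl h)
  then show ?case using x by simp
next
  case (inv h)
  then show ?case
    using x f inv_into_f_f[of f S x] by (simp add: inv_BijGroup Bij_def bij_betw_def)
next
  case (eng g h)
  \<comment> \<open>Multiplication in \<open>BijGroup\<close> unfolds to composition only for
    members of the carrier.\<close>
  have "g \<in> Bij S" "h \<in> Bij S"
    using group.generate_incl[OF group_BijGroup, of "{f}" S] eng.hyps f
    by (auto simp: BijGroup_def)
  then show ?case using eng.IH x by (simp add: BijGroup_def compose_def)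
qed

text \<open>Replaces the generated group by its single generator, the only form in which the fixed
  space is used below.\<close>

lemma fix_space_iff:
  assumes n: "0 < n"
  shows "x \<in> fix_space n (shift_group n m) \<longleftrightarrow>
    x \<in> topspace (Euclidean_space n) \<and> (left_shift n ^^ m) x = x"
proof -
  let ?T = "topspace (Euclidean_space n)"
  let ?f = "restrict (left_shift n ^^ m) ?T"
  have "?f \<in> shift_group n m" by (simp add: shift_group_def generate.incl)
  then show ?thesis
    using generate_fixes[OF shift_power_Bij[OF n, of m], of x]
    unfolding fix_space_def shift_group_def by fastforce
qed

text \<open>The shifted solution has the same initial value as \<open>u\<close>, so uniqueness
  identifies the two.\<close>

lemma lorenz96_solution_in_fix_space:
  assumes n: "0 < n" and u: "lorenz96_solution n F I u" "0 \<in> I" "t \<in> I"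
    and 0: "u 0 \<in> fix_space n (shift_group n m)"
  shows "u t \<in> fix_space n (shift_group n m)"
proof -
  have "(left_shift n ^^ m) (u t) = u t"
    using lorenz96_solution_unique[OF n lorenz96_solution_shift_power[OF n u(1), of m] u(2,3) u] 0
    by (simp add: fix_space_iff[OF n])
  moreover have "u t \<in> topspace (Euclidean_space n)"
    using u by (simp add: lorenz96_solution_def)
  ultimately show ?thesis by (simp add: fix_space_iff[OF n])
qed

section \<open>Repetition and truncation of states\<close>

text \<open>For \<open>n \<le> m\<close> this is truncation to the first \<open>n\<close> coordinates.\<close>

definition repeat_state :: "nat \<Rightarrow> nat \<Rightarrow> (nat \<Rightarrow> real) \<Rightarrow> nat \<Rightarrow> real" where
  "repeat_state n m x = (\<lambda>j. if j < n then x (j mod m) else 0)"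

lemma repeat_state_in_topspace: "repeat_state n m x \<in> topspace (Euclidean_space n)"
  by (simp add: repeat_state_def topspace_Euclidean_space)

text \<open>As \<open>m\<close> divides \<open>n\<close>, reduction modulo \<open>n\<close>
  preserves residues modulo \<open>m\<close>. Hence wrapping around in the long state agrees with
  wrapping around in the short one, also for very small \<open>m\<close>.\<close>

lemma cyc_repeat_state:
  assumes "0 < n" "m dvd n"
  shows "cyc n (repeat_state n m x) j = cyc m x j"
proof -
  have "nat (j mod int n) mod m = nat (j mod int n mod int m)"
    using assms by (simp add: nat_mod_distrib)
  also have "\<dots> = nat (j mod int m)"
    using assms by (simp add: mod_mod_cancel)
  finally show ?thesis
    using assms by (simp add: cyc_def repeat_state_def nat_mod_less)
qed

lemma repeat_state_truncate:
  assumes "0 < n" "m dvd n" "y \<in> topspace (Euclidean_space m)"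
  shows "repeat_state m n (repeat_state n m y) = y"
  using assms dvd_imp_le[of m n] by (auto simp: repeat_state_def topspace_Euclidean_space)

lemma repeat_state_in_fix_space:
  assumes "0 < n" "m dvd n"
  shows "repeat_state n m y \<in> fix_space n (shift_group n m)"
  unfolding fix_space_iff[OF assms(1)]
proof (intro conjI repeat_state_in_topspace ext)
  fix j
  show "(left_shift n ^^ m) (repeat_state n m y) j = repeat_state n m y j"
    using assms unfolding shift_power_apply[OF assms(1) repeat_state_in_topspace]
    by (simp add: repeat_state_def mod_mod_cancel)
qed

lemma truncate_fix_space:
  assumes "0 < n" "m dvd n" "x \<in> fix_space n (shift_group n m)"
  shows "repeat_state n m (repeat_state m n x) = x"
proof
  fix j
  have m: "0 < m" "m \<le> n" using assms dvd_imp_le by (auto intro!: Nat.gr0I)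
  have x: "x \<in> topspace (Euclidean_space n)" "(left_shift n ^^ m) x = x"
    using assms by (auto simp: fix_space_iff)
  \<comment> \<open>Restricting to \<open>j + m < n\<close> avoids the wrap-around; this is enough
    to climb from \<open>j mod m\<close> to \<open>j\<close> in \<open>j div m\<close> steps of
    length \<open>m\<close>.\<close>
  have shift: "x j = x (j + m)" if "j + m < n" for j
    using fun_cong[OF x(2), of j] that by (simp add: shift_power_apply[OF assms(1) x(1)])
  have "x (i + c * m) = x i" if "i + c * m < n" for i c
    using that
  proof (induction c)
    case (Suc c)
    then show ?case using shift[of "i + c * m"] by (simp add: algebra_simps)
  qed simp
  from this[of "j mod m" "j div m"] show "repeat_state n m (repeat_state m n x) j = x j"
    using m x(1) less_le_trans[OF mod_less_divisor[OF m(1), of j] m(2)]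
    by (simp add: repeat_state_def topspace_Euclidean_space)
qed

text \<open>Covers repetition and, with the two dimensions exchanged, truncation. The agreement of
  cyclic readings is required only along \<open>u\<close>, since truncation has it only on the fixed
  space.\<close>

lemma lorenz96_solution_transfer:
  assumes u: "lorenz96_solution m F I u" and j: "\<And>j. j < n \<Longrightarrow> j mod m < m"
    and cyc: "\<And>t i. t \<in> I \<Longrightarrow> cyc n (repeat_state n m (u t)) i = cyc m (u t) i"
  shows "lorenz96_solution n F I (\<lambda>t. repeat_state n m (u t))"
  unfolding lorenz96_solution_def
proof (intro conjI ballI allI impI repeat_state_in_topspace)
  show "open I" "is_interval I" using u by (auto simp: lorenz96_solution_def)
  fix t i assume t: "t \<in> I" and i: "i < n"
  have cyc_mod: "cyc m x (int (i mod m) + c) = cyc m x (int i + c)" for x c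
    by (simp add: cyc_def of_nat_mod mod_add_left_eq)
  have "lorenz96_field n F (repeat_state n m (u t)) i = lorenz96_field m F (u t) (i mod m)"
    using cyc_mod[of "u t" "-1"] cyc_mod[of "u t" 1] cyc_mod[of "u t" 0] cyc_mod[of "u t" "-2"]
    by (simp add: lorenz96_field_def cyc[OF t])
  then show "((\<lambda>s. repeat_state n m (u s) i) has_real_derivative
      lorenz96_field n F (repeat_state n m (u t)) i) (at t)"
    using lorenz96_solution_deriv[OF u t j[OF i]] i by (simp add: repeat_state_def)
qed

lemma lorenz96_solution_repeat:
  assumes "0 < n" "m dvd n" "lorenz96_solution m F I u"
  shows "lorenz96_solution n F I (\<lambda>t. repeat_state n m (u t))"
proof -
  have "0 < m" using assms(1,2) by (auto intro!: Nat.gr0I)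
  then show ?thesis
    using assms by (intro lorenz96_solution_transfer cyc_repeat_state) auto
qed

lemma lorenz96_solution_truncate:
  assumes n: "0 < n" "m dvd n" and u: "lorenz96_solution n F I u" "0 \<in> I"
    and 0: "u 0 \<in> fix_space n (shift_group n m)"
  shows "lorenz96_solution m F I (\<lambda>t. repeat_state m n (u t))"
proof (rule lorenz96_solution_transfer[OF u(1)])
  fix t i assume "t \<in> I"
  then have "u t \<in> fix_space n (shift_group n m)"
    by (rule lorenz96_solution_in_fix_space[OF n(1) u _ 0])
  then show "cyc m (repeat_state m n (u t)) i = cyc n (u t) i"
    \<comment> \<open>In the fixed space \<open>u t\<close> is the repetition of its own truncation,
      so the rule for repetitions is read backwards.\<close>
    using cyc_repeat_state[OF n, of "repeat_state m n (u t)"] truncate_fix_space[OF n] by simp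
qed (use n in simp)

text \<open>Repetition and truncation of a solution both keep its interval \<open>I\<close>, so
  solvability up to \<open>t\<close> passes in both directions.\<close>

lemma lorenz96_times_truncate:
  assumes n: "0 < n" "m dvd n" and x: "x \<in> fix_space n (shift_group n m)"
  shows "lorenz96_times m F (repeat_state m n x) = lorenz96_times n F x"
proof (intro equalityI subsetI)
  have m: "0 < m" using n by (auto intro!: Nat.gr0I)
  fix t assume "t \<in> lorenz96_times m F (repeat_state m n x)"
  then obtain I v where "lorenz96_solution m F I v" "0 \<in> I" "t \<in> I" "v 0 = repeat_state m n x"
    using lorenz96_timesE[OF m] by metis
  then show "t \<in> lorenz96_times n F x"
    using lorenz96_solution_repeat[OF n] truncate_fix_space[OF n x]
    unfolding lorenz96_times_def by fastforce
next
  fix t assume "t \<in> lorenz96_times n F x"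
  then obtain I u where "lorenz96_solution n F I u" "0 \<in> I" "t \<in> I" "u 0 = x"
    using lorenz96_timesE[OF n(1)] by metis
  then show "t \<in> lorenz96_times m F (repeat_state m n x)"
    using lorenz96_solution_truncate[OF n] x unfolding lorenz96_times_def by fastforce
qed

text \<open>The truncated solution starts at the truncated point and is therefore the flow line of
  the small system.\<close>

lemma lorenz96_flow_truncate:
  assumes n: "0 < n" "m dvd n" and x: "x \<in> fix_space n (shift_group n m)"
    and t: "t \<in> lorenz96_times n F x"
  shows "repeat_state m n (lorenz96_flow n F x t) = lorenz96_flow m F (repeat_state m n x) t"
proof -
  obtain I u where u: "lorenz96_solution n F I u" "0 \<in> I" "t \<in> I" "u 0 = x"
    "lorenz96_flow n F x t = u t"
    using lorenz96_timesE[OF n(1) t] by metis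
  have "0 < m" using n by (auto intro!: Nat.gr0I)
  from lorenz96_flow_eq[OF this lorenz96_solution_truncate[OF n u(1,2)] u(2,3)] show ?thesis
    using u x by simp
qed

lemma lorenz96_flow_in_fix_space:
  assumes n: "0 < n" and x: "x \<in> fix_space n (shift_group n m)"
    and t: "t \<in> lorenz96_times n F x"
  shows "lorenz96_flow n F x t \<in> fix_space n (shift_group n m)"
  using lorenz96_timesE[OF n t] lorenz96_solution_in_fix_space[OF n] x by metis

section \<open>The homeomorphism and the topological equivalence\<close>

lemma continuous_map_repeat_state:
  "continuous_map (Euclidean_space m) (Euclidean_space n) (repeat_state n m)"
proof -
  have "continuous_map (Euclidean_space m) euclideanreal (\<lambda>x. repeat_state n m x j)" for j
    unfolding Euclidean_space_def repeat_state_def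
    by (cases "j < n")
      (auto intro: continuous_map_from_subtopology continuous_map_product_projection)
  then show ?thesis
    unfolding Euclidean_space_def[of n] continuous_map_in_subtopology
    by (auto simp: continuous_map_componentwise_UNIV repeat_state_def)
qed

text \<open>Repetition is the inverse. Both maps are continuous because each coordinate is a
  projection or constantly zero.\<close>

lemma homeomorphic_map_truncate:
  assumes n: "0 < n" "m dvd n"
  shows "homeomorphic_map (subtopology (Euclidean_space n) (fix_space n (shift_group n m)))
    (Euclidean_space m) (repeat_state m n)"
  unfolding homeomorphic_map_maps homeomorphic_maps_def
proof (intro exI[of _ "repeat_state n m"] conjI ballI)
  let ?A = "fix_space n (shift_group n m)"
  show "continuous_map (subtopology (Euclidean_space n) ?A) (Euclidean_space m) (repeat_state m n)"
    by (intro continuous_map_from_subtopology continuous_map_repeat_state)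
  show "continuous_map (Euclidean_space m) (subtopology (Euclidean_space n) ?A) (repeat_state n m)"
    using repeat_state_in_fix_space[OF n]
    by (auto simp: continuous_map_in_subtopology continuous_map_repeat_state)
qed (use n in \<open>auto simp: truncate_fix_space repeat_state_truncate\<close>)

theorem proposition2:
  fixes m n k :: nat and F :: real
  assumes "0 < m" and "0 < k" and "n = k * m"
  shows "topologically_equivalent
           (restrict_dynsys (lorenz96 n F) (fix_space n (shift_group n m)))
           (lorenz96 m F)"
proof -
  have n: "0 < n" "m dvd n" using assms by auto
  let ?A = "fix_space n (shift_group n m)"
  let ?D = "restrict_dynsys (lorenz96 n F) ?A" and ?E = "lorenz96 m F"
  have sel: "phase ?D = subtopology (Euclidean_space n) ?A" "phase ?E = Euclidean_space m"
    "times ?D = lorenz96_times n F" "times ?E = lorenz96_times m F"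
    "evol ?D = lorenz96_flow n F" "evol ?E = lorenz96_flow m F"
    by (simp_all add: restrict_dynsys_def lorenz96_def)
  have top: "topspace (phase ?D) = ?A"
    unfolding sel by (auto simp: fix_space_def)
  have "invariant_set ?D ?A"
    using lorenz96_flow_in_fix_space[OF n(1)]
    by (auto simp: invariant_set_def dyn_orbit_def sel)
  moreover have "invariant_set ?E (topspace (phase ?E))"
    unfolding invariant_set_def dyn_orbit_def sel
  proof (intro ballI image_subsetI)
    \<comment> \<open>Flow values are values of solutions, which lie in the phase space by
      definition.\<close>
    fix x t assume "t \<in> lorenz96_times m F x"
    then show "lorenz96_flow m F x t \<in> topspace (Euclidean_space m)"
      by (rule lorenz96_timesE[OF assms(1)]) (simp add: lorenz96_solution_def)
  qed
  moreover have "repeat_state m n ` dyn_orbit ?D x = dyn_orbit ?E (repeat_state m n x)"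
    if "x \<in> ?A" for x
    unfolding dyn_orbit_def sel lorenz96_times_truncate[OF n that] image_image
    using lorenz96_flow_truncate[OF n that] by (rule image_cong[OF refl])
  \<comment> \<open>The identity serves as time change because the intervals of existence
    coincide.\<close>
  moreover have "\<exists>\<tau>::real \<Rightarrow> real.
      strict_mono_on (times ?D x) \<tau> \<and> \<tau> ` times ?D x = times ?E (repeat_state m n x) \<and> \<tau> 0 = 0 \<and>
      (\<forall>t\<in>times ?D x. repeat_state m n (evol ?D x t) = evol ?E (repeat_state m n x) (\<tau> t))"
    if "x \<in> ?A" for x
    using lorenz96_times_truncate[OF n that] lorenz96_flow_truncate[OF n that]
    by (intro exI[of _ "\<lambda>t. t"]) (auto simp: sel strict_mono_on_def)
  ultimately show ?thesis
    unfolding topologically_equivalent_def top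
    using homeomorphic_map_truncate[OF n, folded sel(1,2)]
    by (intro conjI exI[of _ "repeat_state m n"] ballI) auto
qed

end
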